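(* Let $\mathbb{F}_q$ be a finite field of characteristic $p$, $m\ge1$, and let $L$ be a set of monomials in $R=\mathbb{F}_q[x_1,\ldots,x_m]$, each of degree less than $q$ in every variable, which is closed under divisibility. Then every affine transformation $T(x)=Ax+b$ with $b\in\mathbb{F}_q^m$ and $A$ an invertible matrix in $M_L$ is an affine permutation of $L(\mathbb{F}_q^m)$, i.e. $\{Ax+b : A\in M_L \text{ invertible},\ b\in\mathbb{F}_q^m\}\subseteq \mathrm{Perm}_A(L(\mathbb{F}_q^m))$.
   Context: For a Cartesian set $\mathcal{A}=\prod_{i=1}^m A_i$ with $A_i\subseteq\mathbb{F}_q$, $n_i=|A_i|\ge 2$, let $\Delta$ be the set of monomials $u$ with $\deg_{x_i}u<n_i$ for all $i$; for $L\subseteq\Delta$ the code is $L(\mathcal{A})=\mathrm{Span}_{\mathbb{F}_q}\{(f(P_1),\ldots,f(P_n)) : f\in L\}$ where $\mathcal{A}=\{P_1,\ldots,P_n\}$. $I_{\mathcal{A}}=\left(\prod_{\alpha\in A_j}(x_j-\alpha)\right)_{j=1}^m$, and $\overline{g}$ is the unique element of $\mathrm{Span}_{\mathbb{F}_q}(\Delta)$ with $g-\overline{g}\in I_{\mathcal{A}}$. An affine transformation $T(x)=Ax+b$ acts on points by $P\mapsto AP+b$ and on polynomials by $T(f)=f(y_1,\ldots,y_m)$, $(y_1,\ldots,y_m)^t=A(x_1,\ldots,x_m)^t+b$. $T$ is an affine permutation of $L(\mathcal{A})$ if $T(\mathcal{A})=\mathcal{A}$ and $\overline{T(f)}\in\mathrm{Span}_{\mathbb{F}_q}(L)$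 for all $f\in L$; these form $\mathrm{Perm}_A(L(\mathcal{A}))$. Here $\mathcal{A}=\mathbb{F}_q^m$. For naturals $a,c$ write $a\le_p c$ if every $p$-adic digit of $a$ is at most the corresponding digit of $c$. The $p$-Borel graph $G_L$ of $L$ is the directed graph on vertices $x_1,\ldots,x_m$ with an edge $(x_i,x_j)$ iff for every $u\in L$ divisible by $x_i$, the monomial $\left(\frac{x_j}{x_i}\right)^\ell u$ lies in $L$ for all $0\le \ell\le_p \deg_{x_i}(u)$. The space of $L$-stable matrices is $M_L=\{A\in\mathbb{F}_q^{m\times m} : A_{ij}=0 \text{ whenever } (x_i,x_j)\notin E(G_L)\}$. *)

theory Defs
  imports "HOL-Analysis.Analysis" "HOL-Library.Poly_Mapping"
begin

text \<open>A monomial is its exponent vector; polynomials are finitely supported families of coefficients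
  indexed by monomials, with the convolution product of \<open>Poly_Mapping\<close>. Variables are indexed
  by a finite (hence nonempty) type \<open>'m\<close>.\<close>

type_synonym 'm monomial = "'m \<Rightarrow>\<^sub>0 nat"
type_synonym ('m, 'a) mpoly = "('m \<Rightarrow>\<^sub>0 nat) \<Rightarrow>\<^sub>0 'a"

definition const :: "'a \<Rightarrow> ('m, 'a::comm_ring_1) mpoly" where
  "const c = Poly_Mapping.single 0 c"

definition mon :: "'m monomial \<Rightarrow> ('m, 'a::comm_ring_1) mpoly" where
  "mon u = Poly_Mapping.single u 1"

definition var :: "'m \<Rightarrow> ('m, 'a::comm_ring_1) mpoly" where
  "var i = mon (Poly_Mapping.single i 1)"

definition scale :: "'a \<Rightarrow> ('m, 'a::comm_ring_1) mpoly \<Rightarrow> ('m, 'a) mpoly" where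
  "scale c f = const c * f"

lemma const_add: "const (a + b) = const a + const b"
  by (simp add: const_def single_add)

lemma const_mult: "const (a * b) = const a * const b"
  by (simp add: const_def mult_single)

lemma const_1: "const 1 = 1"
  by (simp add: const_def)

text \<open>\<open>mpoly.span\<close> is the linear span over the coefficient field, \<open>mpoly_ideal.span\<close> the ideal
  generated by a set.\<close>

global_interpretation mpoly: vector_space "scale :: 'a::field \<Rightarrow> ('m, 'a) mpoly \<Rightarrow> ('m, 'a) mpoly"
  by unfold_locales (simp_all add: scale_def const_add const_mult const_1 algebra_simps)

global_interpretation mpoly_ideal: module "(*) :: ('m, 'a::field) mpoly \<Rightarrow> ('m, 'a) mpoly \<Rightarrow> ('m, 'a) mpoly"
  by unfold_locales (simp_all add: algebra_simps)

definition cartesian :: "('m \<Rightarrow> 'a set) \<Rightarrow> ('a ^ 'm) set" where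
  "cartesian S = {P. \<forall>i. P $ i \<in> S i}"

definition Delta :: "('m \<Rightarrow> 'a set) \<Rightarrow> 'm monomial set" where
  "Delta S = {u. \<forall>i. Poly_Mapping.lookup u i < card (S i)}"

definition vanishing_ideal :: "('m \<Rightarrow> 'a::field set) \<Rightarrow> ('m, 'a) mpoly set" where
  "vanishing_ideal S = mpoly_ideal.span (range (\<lambda>j. \<Prod>\<alpha>\<in>S j. (var j - const \<alpha>)))"

definition reduce :: "('m \<Rightarrow> 'a::field set) \<Rightarrow> ('m, 'a) mpoly \<Rightarrow> ('m, 'a) mpoly" where
  "reduce S g = (THE h. h \<in> mpoly.span (mon ` Delta S) \<and> g - h \<in> vanishing_ideal S)"

text \<open>The affine transformation \<open>x \<mapsto> A x + b\<close> is given by the pair \<open>(A, b)\<close>, which it determines.\<close>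

definition affine_point :: "('a::field ^ 'm ^ 'm) \<times> ('a ^ 'm) \<Rightarrow> 'a ^ 'm \<Rightarrow> 'a ^ 'm" where
  "affine_point T P = fst T *v P + snd T"

definition affine_coord :: "('a::field ^ 'm ^ 'm) \<times> ('a ^ 'm) \<Rightarrow> 'm \<Rightarrow> ('m, 'a) mpoly" where
  "affine_coord T i = (\<Sum>j\<in>UNIV. const (fst T $ i $ j) * var j) + const (snd T $ i)"

definition affine_subst ::
    "('a::field ^ 'm ^ 'm) \<times> ('a ^ 'm) \<Rightarrow> ('m, 'a) mpoly \<Rightarrow> ('m, 'a) mpoly" where
  "affine_subst T f =
    (\<Sum>u\<in>Poly_Mapping.keys f. const (Poly_Mapping.lookup f u) *
      (\<Prod>i\<in>UNIV. affine_coord T i ^ Poly_Mapping.lookup u i))"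

text \<open>\<open>affine_perms S L\<close> is the set of affine permutations of the code obtained by evaluating the span of
  the monomials \<open>L\<close> on \<open>cartesian S\<close>. Evaluation is injective on the span of \<open>mon ` Delta S\<close>, so for
  \<open>L \<subseteq> Delta S\<close> the code determines \<open>L\<close> and the definition can refer to \<open>L\<close> directly.\<close>

definition affine_perms ::
    "('m \<Rightarrow> 'a::field set) \<Rightarrow> 'm monomial set \<Rightarrow> (('a ^ 'm ^ 'm) \<times> ('a ^ 'm)) set" where
  "affine_perms S L =
    {T. affine_point T ` cartesian S = cartesian S \<and>
        (\<forall>u\<in>L. reduce S (affine_subst T (mon u)) \<in> mpoly.span (mon ` L))}"

definition digit_le :: "nat \<Rightarrow> nat \<Rightarrow> nat \<Rightarrow> bool" where
  "digit_le p a c \<longleftrightarrow> (\<forall>k. (a div p ^ k) mod p \<le> (c div p ^ k) mod p)"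

definition mon_dvd :: "'m monomial \<Rightarrow> 'm monomial \<Rightarrow> bool" where
  "mon_dvd v u \<longleftrightarrow> (\<exists>w. u = v + w)"

text \<open>\<open>digit_le p l a\<close> implies \<open>l \<le> a\<close> for \<open>p > 1\<close>, so the truncated subtraction of exponent
  vectors below never truncates.\<close>

definition borel_edges :: "nat \<Rightarrow> 'm monomial set \<Rightarrow> ('m \<times> 'm) set" where
  "borel_edges p L = {(i, j). \<forall>u\<in>L. mon_dvd (Poly_Mapping.single i 1) u \<longrightarrow>
     (\<forall>l. digit_le p l (Poly_Mapping.lookup u i) \<longrightarrow>
        u - Poly_Mapping.single i l + Poly_Mapping.single j l \<in> L)}"

definition stable_matrices :: "'m monomial set \<Rightarrow> ('a::field ^ 'm ^ 'm) set" where
  "stable_matrices L = {A. \<forall>i j. (i, j) \<notin> borel_edges CHAR('a) L \<longrightarrow> A $ i $ j = 0}"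

end

theory Submission
  imports Defs
begin

text \<open>An affine substitution with matrix in \<open>M\<^sub>L\<close> maps the span of \<open>L\<close> into itself as polynomials, so no
  reduction ever takes place. For a single transvection \<open>x\<^sub>i \<mapsto> x\<^sub>i + t x\<^sub>j\<close> this is the binomial theorem
  together with Lucas' theorem, for translations it is closure under divisibility. The edges form a
  preorder, and an invertible matrix supported on a preorder is a product of elementary matrices
  supported on it.\<close>

subsection \<open>The preorder of admissible moves\<close>

text \<open>Two obstacles shape the proof. Eliminating one entry of \<open>A\<close> fills in
  others, and only transitivity keeps the fill-in on edges; but transitivity is not evident, since
  an amount moved from \<open>i\<close> to \<open>j\<close> is added to the exponent already at
  \<open>j\<close>, where carries in base p may block moving it on to \<open>k\<close>. Moreover, a
  zero on the diagonal cannot be mended with an arbitrary column: adding column \<open>j\<close> to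
  column \<open>i\<close> is admissible only along an edge from \<open>j\<close> to
  \<open>i\<close>, whereas a nonzero entry in row \<open>i\<close> only provides the opposite
  edge.\<close>

lemma prime_dvd_choose_mult:
  fixes p :: nat
  assumes "prime p" "\<not> p dvd k"
  shows "p dvd (p * n choose k)"
proof -
  have "0 < k" using assms(2) by (cases k) auto
  \<comment> \<open>Absorption: k * C(pn, k) = pn * C(pn - 1, k - 1).\<close>
  then have "p dvd k * (p * n choose k)"
    by (simp add: times_binomial_minus1_eq)
  then show ?thesis
    using assms by (simp add: prime_dvd_mult_iff)
qed

text \<open>Vandermonde for pa + p gives C(pa, pl) = C(a, l) modulo p by induction on a: only the
  terms k = 0 and k = p survive, and they reproduce Pascal's rule.\<close>

lemma prime_dvd_choose_mult_mult:
  fixes p :: nat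
  assumes "prime p" "p dvd (a choose l)"
  shows "p dvd (p * a choose (p * l))"
proof -
  have cong: "(p * a choose (p * l)) mod p = (a choose l) mod p" for a l
  proof (induction a arbitrary: l)
    case 0
    then show ?case using assms(1) by (cases l) (auto simp: prime_gt_0_nat binomial_eq_0)
  next
    case (Suc a)
    show ?case
    proof (cases l)
      case 0
      then show ?thesis by simp
    next
      case (Suc l')
      let ?f = "\<lambda>k. (p choose k) * (p * a choose (p * l - k))"
      have p: "p > 1" using assms(1) by (rule prime_gt_1_nat)
      have pl: "p \<le> p * l" using Suc by simp
      have "(p * Suc a choose (p * l)) = (\<Sum>k\<le>p * l. ?f k)"
        using vandermonde[of p "p * a" "p * l"] by simp
      also have "\<dots> = (\<Sum>k\<in>{0, p}. ?f k) + (\<Sum>k\<in>{..p * l} - {0, p}. ?f k)"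
        using pl by (subst sum.subset_diff[of "{0, p}"]) auto
      also have "(\<Sum>k\<in>{0, p}. ?f k) = (p * a choose (p * l)) + (p * a choose (p * l'))"
        using p Suc by simp
      finally have eq: "(p * Suc a choose (p * l)) = (p * a choose (p * l)) + (p * a choose (p * l'))
          + (\<Sum>k\<in>{..p * l} - {0, p}. ?f k)" .
      have "p dvd (\<Sum>k\<in>{..p * l} - {0, p}. ?f k)"
      proof (rule dvd_sum)
        fix k assume k: "k \<in> {..p * l} - {0, p}"
        have "p dvd (p choose k)"
        proof (cases "k < p")
          case True
          then show ?thesis using k assms(1) prime_dvd_choose_mult[of p k 1] by (simp add: nat_dvd_not_less)
        next
          case False
          then show ?thesis using k by (simp add: binomial_eq_0)
        qed
        then show "p dvd ?f k" by simp
      qed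
      then have "(p * Suc a choose (p * l)) mod p
          = ((p * a choose (p * l)) + (p * a choose (p * l'))) mod p"
        unfolding eq by (elim dvdE) (simp only: mod_mult_self2)
      also have "\<dots> = ((a choose l) + (a choose l')) mod p"
        by (rule mod_add_cong) (rule Suc.IH)+
      finally show ?thesis using Suc by (simp add: add.commute)
    qed
  qed
  show ?thesis
    using assms(2) cong[of a l] by (simp add: dvd_eq_mod_eq_0)
qed

text \<open>One step of Lucas' theorem. Splitting a as p * (a div p) + a mod p, some Vandermonde
  term is nonzero modulo p; there p divides k and l - k \<le> a mod p < p, so k and l - k are the
  higher part and the last digit of l.\<close>

lemma not_dvd_choose_digits:
  fixes p :: nat
  assumes "prime p" "\<not> p dvd (a choose l)"
  shows "l mod p \<le> a mod p" "\<not> p dvd (a div p choose (l div p))"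
proof -
  have p: "p > 0" using assms(1) by (rule prime_gt_0_nat)
  have "(\<Sum>k\<le>l. (p * (a div p) choose k) * (a mod p choose (l - k))) = (a choose l)"
    using vandermonde[of "p * (a div p)" "a mod p" l] by simp
  then obtain k where k: "k \<le> l" "\<not> p dvd (p * (a div p) choose k) * (a mod p choose (l - k))"
    using assms(2) dvd_sum by (metis (no_types, lifting) atMost_iff)
  then have k1: "\<not> p dvd (p * (a div p) choose k)" and k2: "\<not> p dvd (a mod p choose (l - k))"
    by auto
  have "p dvd k" using prime_dvd_choose_mult[OF assms(1)] k1 by blast
  then obtain k' where k': "k = p * k'" by blast
  have le: "l - k \<le> a mod p"
    using k2 by (metis binomial_eq_0 dvd_0_right not_le)
  then have lt: "l - k < p" using p by (meson le_less_trans mod_less_divisor)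
  have l: "l = (l - k) + p * k'" using k' k(1) by simp
  have "l mod p = l - k" using lt by (subst l) simp
  then show "l mod p \<le> a mod p" using le by simp
  have "l div p = k'" using lt p by (subst l) simp
  then show "\<not> p dvd (a div p choose (l div p))"
    using k1 k' prime_dvd_choose_mult_mult[OF assms(1)] by blast
qed

lemma not_dvd_choose_imp_digit_le:
  assumes "prime p" "\<not> p dvd (a choose l)"
  shows "digit_le p l a"
proof -
  have "\<not> p dvd (a div p ^ k choose (l div p ^ k))" for k
  proof (induction k)
    case (Suc k)
    then show ?case
      using not_dvd_choose_digits(2)[OF assms(1) Suc.IH]
      by (simp add: div_mult2_eq mult.commute[of p])
  qed (use assms(2) in simp)
  then show ?thesis
    unfolding digit_le_def using not_dvd_choose_digits(1)[OF assms(1)] by blast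
qed

text \<open>By Lucas' theorem this is the edge condition of the \<open>p\<close>-Borel graph in terms of binomial coefficients;
  only one inclusion is needed, and binomial coefficients make transitivity accessible.\<close>

definition move_edges :: "nat \<Rightarrow> 'm monomial set \<Rightarrow> ('m \<times> 'm) set" where
  "move_edges p L = {(i, j). \<forall>u\<in>L. \<forall>l. \<not> p dvd (Poly_Mapping.lookup u i choose l) \<longrightarrow>
     u - Poly_Mapping.single i l + Poly_Mapping.single j l \<in> L}"

lemma move_edgesD:
  assumes "(i, j) \<in> move_edges p L" "u \<in> L" "\<not> p dvd (Poly_Mapping.lookup u i choose l)"
  shows "u - Poly_Mapping.single i l + Poly_Mapping.single j l \<in> L"
  using assms unfolding move_edges_def by blast

text \<open>Borel edges constrain only monomials divisible by the source variable. A nonzero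
  coefficient with l > 0 forces this divisibility, and l = 0 moves nothing.\<close>

lemma borel_edges_subset_move_edges:
  assumes "prime p"
  shows "borel_edges p L \<subseteq> move_edges p L"
proof (clarsimp simp: move_edges_def)
  fix i j and u :: "'a monomial" and l
  assume e: "(i, j) \<in> borel_edges p L" and u: "u \<in> L"
    and nd: "\<not> p dvd (Poly_Mapping.lookup u i choose l)"
  show "u - Poly_Mapping.single i l + Poly_Mapping.single j l \<in> L"
  proof (cases "l = 0")
    case False
    then have "Poly_Mapping.lookup u i > 0"
      using nd by (cases l) (auto intro: Nat.gr0I)
    then have "u = Poly_Mapping.single i 1 + (u - Poly_Mapping.single i 1)"
      by (intro poly_mapping_eqI) (auto simp: lookup_add lookup_minus lookup_single when_def)
    then have "mon_dvd (Poly_Mapping.single i 1) u"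
      unfolding mon_dvd_def by blast
    then show ?thesis
      using e u not_dvd_choose_imp_digit_le[OF assms nd] unfolding borel_edges_def by blast
  qed (use u in simp)
qed

lemma not_dvd_choose_le:
  fixes p :: nat
  assumes "\<not> p dvd (a choose l)"
  shows "l \<le> a"
  using assms by (metis binomial_eq_0 dvd_0_right not_le)

lemma move_edges_refl: "(i, i) \<in> move_edges p L"
proof (clarsimp simp: move_edges_def)
  fix u :: "'a monomial" and l
  assume u: "u \<in> L" and nd: "\<not> p dvd (Poly_Mapping.lookup u i choose l)"
  have "u - Poly_Mapping.single i l + Poly_Mapping.single i l = u"
    using not_dvd_choose_le[OF nd]
    by (intro poly_mapping_eqI) (auto simp: lookup_add lookup_minus lookup_single when_def)
  then show "u - Poly_Mapping.single i l + Poly_Mapping.single i l \<in> L" using u by simp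
qed

text \<open>If moving \<open>l\<close> along \<open>i \<rightarrow> j \<rightarrow> k\<close> is blocked by a vanishing binomial coefficient,
  Vandermonde's identity provides a smaller \<open>r\<close> such that one may move \<open>r\<close> along \<open>i \<rightarrow> k\<close>
  and then \<open>l - r\<close> along \<open>j \<rightarrow> k\<close> and \<open>i \<rightarrow> j\<close>, in this order.\<close>

lemma move_edges_trans:
  assumes p: "prime p" and ij: "(i, j) \<in> move_edges p L" and jk: "(j, k) \<in> move_edges p L"
  shows "(i, k) \<in> move_edges p L"
proof (cases "i = j \<or> j = k \<or> i = k")
  case True
  then show ?thesis using ij jk by (auto intro: move_edges_refl)
next
  case False
  then have ne: "i \<noteq> j" "j \<noteq> k" "i \<noteq> k" by auto
  note lookups = lookup_add lookup_minus lookup_single when_def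
  have "u - Poly_Mapping.single i l + Poly_Mapping.single k l \<in> L"
    if "u \<in> L" "\<not> p dvd (Poly_Mapping.lookup u i choose l)" for u l
    using that
  proof (induction l arbitrary: u rule: less_induct)
    case (less l)
    let ?a = "Poly_Mapping.lookup u i" and ?c = "Poly_Mapping.lookup u j"
    have la: "l \<le> ?a" using not_dvd_choose_le[OF less.prems(2)] .
    show ?case
    proof (cases "p dvd (l + ?c choose l)")
      case False
      let ?v = "u - Poly_Mapping.single i l + Poly_Mapping.single j l"
      have "?v \<in> L" using move_edgesD[OF ij less.prems] .
      moreover have "Poly_Mapping.lookup ?v j = l + ?c" using ne by (simp add: lookups)
      ultimately have "?v - Poly_Mapping.single j l + Poly_Mapping.single k l \<in> L"
        using move_edgesD[OF jk, of ?v l] False by simp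
      moreover have "?v - Poly_Mapping.single j l + Poly_Mapping.single k l
          = u - Poly_Mapping.single i l + Poly_Mapping.single k l"
        using ne by (intro poly_mapping_eqI) (auto simp: lookups)
      ultimately show ?thesis by simp
    next
      case True
      \<comment> \<open>The term r = l equals 1. As p divides the whole sum, it cannot divide the
        rest, so some r < l has a nonzero term.\<close>
      have "(\<Sum>r\<le>l. (l choose r) * (?c choose (l - r)))
          = (\<Sum>r<l. (l choose r) * (?c choose (l - r))) + 1"
        by (simp add: lessThan_Suc_atMost[symmetric])
      then have "(l + ?c choose l) = (\<Sum>r<l. (l choose r) * (?c choose (l - r))) + 1"
        by (simp add: vandermonde)
      moreover have "\<not> p dvd 1" using not_prime_1 p by auto
      ultimately have "\<not> p dvd (\<Sum>r<l. (l choose r) * (?c choose (l - r)))"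
        using True by (metis dvd_add_right_iff)
      then obtain r where r: "r < l" "\<not> p dvd (l choose r) * (?c choose (l - r))"
        using dvd_sum by (metis (no_types, lifting) lessThan_iff)
      then have r1: "\<not> p dvd (l choose r)" and r2: "\<not> p dvd (?c choose (l - r))" by auto
      \<comment> \<open>Both factors on the left are units modulo p, hence so are both on the
        right.\<close>
      have "(?a choose l) * (l choose r) = (?a choose r) * (?a - r choose (l - r))"
        using choose_mult[of r l ?a] r la by simp
      moreover have "\<not> p dvd (?a choose l) * (l choose r)"
        using p r1 less.prems(2) by (simp add: prime_dvd_mult_iff)
      ultimately have r3: "\<not> p dvd (?a choose r)" and r4: "\<not> p dvd (?a - r choose (l - r))"
        by auto
      define s where "s = l - r"
      let ?u1 = "u - Poly_Mapping.single i r + Poly_Mapping.single k r"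
      let ?u2 = "?u1 - Poly_Mapping.single j s + Poly_Mapping.single k s"
      let ?u3 = "?u2 - Poly_Mapping.single i s + Poly_Mapping.single j s"
      \<comment> \<open>The exponent of \<open>j\<close> is still \<open>?c\<close> in
        \<open>?u1\<close>, so \<open>r2\<close> allows emptying \<open>s\<close> out of it; the
        exponent of \<open>i\<close> is then \<open>?a - r\<close>, so \<open>r4\<close> allows
        refilling \<open>j\<close> from \<open>i\<close>.\<close>
      have "?u1 \<in> L" using less.IH[OF r(1) less.prems(1) r3] .
      then have "?u2 \<in> L"
        using move_edgesD[OF jk, of ?u1 s] r2 ne by (simp add: lookups s_def)
      then have "?u3 \<in> L"
        using move_edgesD[OF ij, of ?u2 s] r4 ne by (simp add: lookups s_def)
      moreover have "?u3 = u - Poly_Mapping.single i l + Poly_Mapping.single k l"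
        using ne r(1) la not_dvd_choose_le[OF r2]
        by (intro poly_mapping_eqI) (auto simp: lookups s_def)
      ultimately show ?thesis by simp
    qed
  qed
  then show ?thesis unfolding move_edges_def by blast
qed

subsection \<open>Substitutions preserving the span of \<open>L\<close>\<close>

text \<open>Arbitrary families of polynomials are allowed, so that affine maps, updates of a single
  variable and evaluation at a point are all instances.\<close>

definition mono_subst :: "('m::finite \<Rightarrow> ('n, 'a::comm_ring_1) mpoly) \<Rightarrow> 'm monomial \<Rightarrow> ('n, 'a) mpoly" where
  "mono_subst c u = (\<Prod>i\<in>UNIV. c i ^ Poly_Mapping.lookup u i)"

definition subst :: "('m::finite \<Rightarrow> ('n, 'a::comm_ring_1) mpoly) \<Rightarrow> ('m, 'a) mpoly \<Rightarrow> ('n, 'a) mpoly" where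
  "subst c f = (\<Sum>u\<in>Poly_Mapping.keys f. const (Poly_Mapping.lookup f u) * mono_subst c u)"

section \<open>Substitution as a ring homomorphism\<close>

lemma const_0 [simp]: "const 0 = 0"
  by (simp add: const_def)

lemma const_power: "const a ^ n = const (a ^ n)"
  by (induction n) (simp_all add: const_1 const_mult)

lemma const_of_nat: "const (of_nat n) = of_nat n"
  by (induction n) (simp_all add: const_1 const_add)

lemma mono_subst_add: "mono_subst c (u + v) = mono_subst c u * mono_subst c v"
  by (simp add: mono_subst_def lookup_add power_add prod.distrib)

lemma subst_superset:
  assumes "finite K" "Poly_Mapping.keys f \<subseteq> K"
  shows "subst c f = (\<Sum>u\<in>K. const (Poly_Mapping.lookup f u) * mono_subst c u)"
  unfolding subst_def
  by (rule sum.mono_neutral_left) (use assms in \<open>auto simp: in_keys_iff\<close>)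

lemma subst_add: "subst c (f + g) = subst c f + subst c g"
proof -
  let ?K = "Poly_Mapping.keys f \<union> Poly_Mapping.keys g"
  have "Poly_Mapping.keys (f + g) \<subseteq> ?K" by (rule keys_add)
  then show ?thesis
    by (simp add: subst_superset[of ?K] lookup_add const_add algebra_simps sum.distrib)
qed

lemma subst_0 [simp]: "subst c 0 = 0"
  by (simp add: subst_def)

lemma subst_sum: "subst c (\<Sum>x\<in>X. f x) = (\<Sum>x\<in>X. subst c (f x))"
  by (induction X rule: infinite_finite_induct) (simp_all add: subst_add)

lemma subst_single: "subst c (Poly_Mapping.single u a) = const a * mono_subst c u"
  by (simp add: subst_def)

lemma mpoly_eq_sum_single:
  "f = (\<Sum>u\<in>Poly_Mapping.keys f. Poly_Mapping.single u (Poly_Mapping.lookup f u))"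
  by (intro poly_mapping_eqI)
    (simp add: lookup_sum lookup_single when_def in_keys_iff sum.delta)

lemma subst_mult: "subst c (f * g) = subst c f * subst c g"
proof -
  let ?s = "\<lambda>f u. Poly_Mapping.single u (Poly_Mapping.lookup f u)"
  have "f * g = (\<Sum>u\<in>Poly_Mapping.keys f. \<Sum>v\<in>Poly_Mapping.keys g. ?s f u * ?s g v)"
    by (subst (1) mpoly_eq_sum_single[of f], subst (1) mpoly_eq_sum_single[of g])
      (simp add: sum_product)
  also have "subst c \<dots> = (\<Sum>u\<in>Poly_Mapping.keys f. \<Sum>v\<in>Poly_Mapping.keys g. subst c (?s f u) * subst c (?s g v))"
    by (simp add: subst_sum mult_single subst_single const_mult mono_subst_add mult_ac)
  also have "\<dots> = (\<Sum>u\<in>Poly_Mapping.keys f. subst c (?s f u)) * (\<Sum>v\<in>Poly_Mapping.keys g. subst c (?s g v))"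
    by (simp add: sum_product)
  also have "\<dots> = subst c f * subst c g"
    by (simp flip: subst_sum mpoly_eq_sum_single)
  finally show ?thesis .
qed

lemma mono_subst_0 [simp]: "mono_subst c 0 = 1"
  by (simp add: mono_subst_def)

lemma subst_const [simp]: "subst c (const a) = const a"
  by (simp add: const_def subst_single)

lemma subst_1 [simp]: "subst c 1 = 1"
  using subst_const[of c 1] by (simp add: const_1)

lemma subst_diff: "subst c (f - g) = subst c f - subst c g"
  using subst_add[of c "f - g" g] by (simp add: algebra_simps)

lemma subst_power: "subst c (f ^ n) = subst c f ^ n"
  by (induction n) (simp_all add: subst_mult)

lemma subst_prod: "subst c (\<Prod>x\<in>X. f x) = (\<Prod>x\<in>X. subst c (f x))"
  by (induction X rule: infinite_finite_induct) (simp_all add: subst_mult)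

lemma subst_mon: "subst c (mon u) = mono_subst c u"
  by (simp add: mon_def subst_single const_1)

lemma subst_var [simp]: "subst c (var i) = c i"
proof -
  have "mono_subst c (Poly_Mapping.single i 1) = (\<Prod>j\<in>UNIV. if j = i then c i else 1)"
    unfolding mono_subst_def by (intro prod.cong) (auto simp: lookup_single when_def)
  then show ?thesis by (simp add: var_def subst_mon)
qed

lemma subst_mono_subst: "subst d (mono_subst c u) = mono_subst (\<lambda>i. subst d (c i)) u"
  by (simp add: mono_subst_def subst_prod subst_power)

lemma affine_subst_mon: "affine_subst T (mon u) = mono_subst (affine_coord T) u"
  by (simp add: affine_subst_def subst_def[symmetric] mono_subst_def[symmetric] subst_mon)

lemma var_power: "var i ^ n = mon (Poly_Mapping.single i n)"
  by (induction n) (simp_all add: var_def mon_def mult_single single_add[symmetric])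

lemma mon_add: "mon (u + v) = mon u * mon v"
  by (simp add: mon_def mult_single)

lemma mon_0: "mon 0 = 1"
  by (simp add: mon_def)

lemma prod_mon: "(\<Prod>x\<in>X. mon (f x)) = mon (\<Sum>x\<in>X. f x)"
  by (induction X rule: infinite_finite_induct) (simp_all add: mon_add mon_0)

text \<open>Isolates the power of the one affected variable, to which the binomial theorem is then
  applied.\<close>

lemma mono_subst_upd:
  fixes u :: "'m::finite monomial"
  shows "mono_subst (var(i := f)) u = f ^ Poly_Mapping.lookup u i *
    mon (u - Poly_Mapping.single i (Poly_Mapping.lookup u i))"
proof -
  have "mono_subst (var(i := f)) u = f ^ Poly_Mapping.lookup u i *
      (\<Prod>k\<in>UNIV - {i}. (var(i := f)) k ^ Poly_Mapping.lookup u k)"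
    unfolding mono_subst_def by (subst prod.remove[of _ i]) auto
  also have "(\<Prod>k\<in>UNIV - {i}. (var(i := f)) k ^ Poly_Mapping.lookup u k)
      = (\<Prod>k\<in>UNIV - {i}. mon (Poly_Mapping.single k (Poly_Mapping.lookup u k)))"
    by (intro prod.cong) (auto simp: var_power)
  also have "\<dots> = mon (\<Sum>k\<in>UNIV - {i}. Poly_Mapping.single k (Poly_Mapping.lookup u k))"
    by (rule prod_mon)
  also have "(\<Sum>k\<in>UNIV - {i}. Poly_Mapping.single k (Poly_Mapping.lookup u k))
      = u - Poly_Mapping.single i (Poly_Mapping.lookup u i)"
    by (intro poly_mapping_eqI) (auto simp: lookup_sum lookup_minus lookup_single when_def sum.delta)
  finally show ?thesis .
qed

definition preserves :: "'m::finite monomial set \<Rightarrow> ('m \<Rightarrow> ('m, 'a::field) mpoly) \<Rightarrow> bool" where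
  "preserves L c \<longleftrightarrow> (\<forall>u\<in>L. mono_subst c u \<in> mpoly.span (mon ` L))"

lemma const_mult_in_span: "f \<in> mpoly.span S \<Longrightarrow> const a * f \<in> mpoly.span S"
  using mpoly.span_scale unfolding scale_def by blast

lemma subst_in_span:
  assumes "preserves L c" "f \<in> mpoly.span (mon ` L)"
  shows "subst c f \<in> mpoly.span (mon ` L)"
  using assms(2)
proof (induction rule: mpoly.span_induct_alt)
  case base
  then show ?case by (simp add: mpoly.span_zero)
next
  case (step a x y)
  then have "subst c x \<in> mpoly.span (mon ` L)"
    using assms(1) by (auto simp: preserves_def subst_mon)
  moreover have "subst c (scale a x + y) = scale a (subst c x) + subst c y"
    by (simp add: subst_add scale_def subst_mult)
  ultimately show ?case
    using step.IH by (simp add: mpoly.span_add mpoly.span_scale)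
qed

text \<open>\<open>subst e\<close> is \<open>subst c\<close> followed by \<open>subst d\<close>, so
  the substitution applied last is the one inserted into the coordinates.\<close>

lemma preserves_comp:
  assumes "preserves L c" "preserves L d" "\<And>i. e i = subst d (c i)"
  shows "preserves L e"
proof -
  have "e = (\<lambda>i. subst d (c i))" using assms(3) by blast
  then show ?thesis
    using assms(1) subst_in_span[OF assms(2)]
    unfolding preserves_def by (simp flip: subst_mono_subst)
qed

text \<open>Terms whose coefficient vanishes in the field may carry monomials outside
  \<open>L\<close>; this is where binomial coefficients divisible by p drop out.\<close>

lemma const_mult_mon_in_span:
  assumes "a \<noteq> 0 \<Longrightarrow> v \<in> L"
  shows "const a * mon v \<in> mpoly.span (mon ` L)"
proof (cases "a = 0")
  case True
  then show ?thesis by (simp add: mpoly.span_zero)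
next
  case False
  then show ?thesis
    using assms by (intro const_mult_in_span mpoly.span_base) auto
qed

text \<open>A monomial is only multiplied by a constant. The case a = 0 is included, so later
  diagonal factors may vanish.\<close>

lemma preserves_scaling: "preserves L (var(i := const a * var i))"
proof (clarsimp simp: preserves_def mono_subst_upd)
  fix u assume u: "u \<in> L"
  let ?n = "Poly_Mapping.lookup u i"
  have "Poly_Mapping.single i ?n + (u - Poly_Mapping.single i ?n) = u"
    by (intro poly_mapping_eqI) (auto simp: lookup_add lookup_minus lookup_single when_def)
  then have "mon (Poly_Mapping.single i ?n) * mon (u - Poly_Mapping.single i ?n) = (mon u :: ('a, 'b) mpoly)"
    by (simp only: mon_add[symmetric])
  then have "(const a * var i) ^ ?n * mon (u - Poly_Mapping.single i ?n) = const (a ^ ?n) * mon u"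
    by (simp only: power_mult_distrib var_power mult.assoc const_power)
  also have "\<dots> \<in> mpoly.span (mon ` L)"
    using u by (intro const_mult_mon_in_span)
  finally show "(const a * var i) ^ ?n * mon (u - Poly_Mapping.single i ?n) \<in> mpoly.span (mon ` L)" .
qed

lemma preserves_transvection:
  fixes L :: "'m::finite monomial set" and t :: "'a::field"
  assumes "(i, j) \<in> move_edges CHAR('a) L"
  shows "preserves L (var(i := var i + const t * var j))"
proof (clarsimp simp: preserves_def mono_subst_upd)
  fix u assume u: "u \<in> L"
  let ?n = "Poly_Mapping.lookup u i"
  let ?r = "u - Poly_Mapping.single i ?n"
  have "of_nat (?n choose l) * (const t * var j) ^ l * var i ^ (?n - l) * mon ?r
      \<in> mpoly.span (mon ` L)" if "l \<le> ?n" for l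
  proof -
    have "Poly_Mapping.single j l + Poly_Mapping.single i (?n - l) + ?r
        = u - Poly_Mapping.single i l + Poly_Mapping.single j l"
      using that by (intro poly_mapping_eqI) (auto simp: lookup_add lookup_minus lookup_single when_def)
    then have "mon (Poly_Mapping.single j l) * mon (Poly_Mapping.single i (?n - l)) * mon ?r
        = (mon (u - Poly_Mapping.single i l + Poly_Mapping.single j l) :: ('m, 'a) mpoly)"
      by (simp only: mon_add[symmetric])
    then have "of_nat (?n choose l) * (const t * var j) ^ l * var i ^ (?n - l) * mon ?r
        = const (of_nat (?n choose l) * t ^ l) * mon (u - Poly_Mapping.single i l + Poly_Mapping.single j l)"
      by (simp only: power_mult_distrib var_power const_power const_mult const_of_nat mult.assoc)
    also have "\<dots> \<in> mpoly.span (mon ` L)"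
      using move_edgesD[OF assms u, of l] by (intro const_mult_mon_in_span) (auto simp: of_nat_eq_0_iff_char_dvd)
    finally show ?thesis .
  qed
  \<comment> \<open>With the summands in this order, the index in \<open>binomial_ring\<close> is
    the amount moved to \<open>j\<close>.\<close>
  then have "(const t * var j + var i) ^ ?n * mon ?r \<in> mpoly.span (mon ` L)"
    unfolding binomial_ring sum_distrib_right by (intro mpoly.span_sum) auto
  then show "(var i + const t * var j) ^ ?n * mon ?r \<in> mpoly.span (mon ` L)"
    by (simp add: add.commute)
qed

text \<open>Every monomial in the expansion arises from \<open>u\<close> by lowering one exponent,
  hence divides \<open>u\<close>.\<close>

lemma preserves_single_translation:
  fixes L :: "'m::finite monomial set" and t :: "'a::field"
  assumes "\<And>u v. u \<in> L \<Longrightarrow> mon_dvd v u \<Longrightarrow> v \<in> L"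
  shows "preserves L (var(i := var i + const t))"
proof (clarsimp simp: preserves_def mono_subst_upd)
  fix u assume u: "u \<in> L"
  let ?n = "Poly_Mapping.lookup u i"
  let ?r = "u - Poly_Mapping.single i ?n"
  have "of_nat (?n choose l) * const t ^ l * var i ^ (?n - l) * mon ?r
      \<in> mpoly.span (mon ` L)" if "l \<le> ?n" for l
  proof -
    have "Poly_Mapping.single i (?n - l) + ?r = u - Poly_Mapping.single i l"
      using that by (intro poly_mapping_eqI) (auto simp: lookup_add lookup_minus lookup_single when_def)
    then have "mon (Poly_Mapping.single i (?n - l)) * mon ?r
        = (mon (u - Poly_Mapping.single i l) :: ('m, 'a) mpoly)"
      by (simp only: mon_add[symmetric])
    then have "of_nat (?n choose l) * const t ^ l * var i ^ (?n - l) * mon ?r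
        = const (of_nat (?n choose l) * t ^ l) * mon (u - Poly_Mapping.single i l)"
      by (simp only: var_power const_power const_mult const_of_nat mult.assoc)
    also have "\<dots> \<in> mpoly.span (mon ` L)"
    proof (rule const_mult_mon_in_span)
      have "u = (u - Poly_Mapping.single i l) + Poly_Mapping.single i l"
        using that by (intro poly_mapping_eqI) (auto simp: lookup_add lookup_minus lookup_single when_def)
      then have "mon_dvd (u - Poly_Mapping.single i l) u" unfolding mon_dvd_def by blast
      then show "u - Poly_Mapping.single i l \<in> L" using assms u by blast
    qed
    finally show ?thesis .
  qed
  then have "(const t + var i) ^ ?n * mon ?r \<in> mpoly.span (mon ` L)"
    unfolding binomial_ring sum_distrib_right by (intro mpoly.span_sum) auto
  then show "(var i + const t) ^ ?n * mon ?r \<in> mpoly.span (mon ` L)"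
    by (simp add: add.commute)
qed

lemma preserves_var: "preserves L var"
  \<comment> \<open>Scaling any variable by 1 is the identity, so the index is arbitrary.\<close>
  using preserves_scaling[of L undefined 1] by (simp add: const_1)

lemma preserves_translation:
  fixes L :: "'m::finite monomial set" and b :: "'m \<Rightarrow> 'a::field"
  assumes "\<And>u v. u \<in> L \<Longrightarrow> mon_dvd v u \<Longrightarrow> v \<in> L"
  shows "preserves L (\<lambda>i. var i + const (b i))"
proof -
  have "preserves L (\<lambda>i. var i + const (if i \<in> I then b i else 0))" if "finite I" for I
    using that
  proof (induction I)
    case empty
    then show ?case using preserves_var by simp
  next
    case (insert i I)
    show ?case
    proof (rule preserves_comp[OF insert.IH])
      show "preserves L (var(i := var i + const (b i)))"
        by (rule preserves_single_translation) (rule assms)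
      show "var k + const (if k \<in> insert i I then b k else 0)
          = subst (var(i := var i + const (b i))) (var k + const (if k \<in> I then b k else 0))" for k
        using insert.hyps by (auto simp: subst_add)
    qed
  qed
  from this[of UNIV] show ?thesis by simp
qed

lemma preserves_upd_linear:
  fixes L :: "'m::finite monomial set" and c :: "'m \<Rightarrow> 'a::field"
  assumes "\<And>j. c j \<noteq> 0 \<Longrightarrow> (i, j) \<in> move_edges CHAR('a) L"
  shows "preserves L (var(i := var i + (\<Sum>j\<in>UNIV. const (c j) * var j)))"
proof -
  have sum: "preserves L (var(i := var i + (\<Sum>j\<in>J. const (c j) * var j)))" if "finite J" "i \<notin> J" for J
    using that
  proof (induction J)
    case empty
    then show ?case using preserves_var by simp
  next
    case (insert j J)
    let ?d = "var(i := var i + const (c j) * var j) :: 'm \<Rightarrow> ('m, 'a) mpoly"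
    \<comment> \<open>If \<open>c j\<close> = 0 no edge is at hand, but the transvection is then the
      identity.\<close>
    have d: "preserves L ?d"
      using preserves_transvection[OF assms, of j "c j"] preserves_var[of L] by (cases "c j = 0") auto
    have "(\<Sum>k\<in>J. subst ?d (const (c k) * var k)) = (\<Sum>k\<in>J. const (c k) * var k)"
      using insert.prems by (intro sum.cong) (auto simp: subst_mult)
    then have eq: "(var(i := var i + (\<Sum>j\<in>insert j J. const (c j) * var j))) k
        = subst ?d ((var(i := var i + (\<Sum>j\<in>J. const (c j) * var j))) k)" for k
      using insert.hyps insert.prems by (auto simp: subst_add subst_sum add.assoc)
    have "preserves L (var(i := var i + (\<Sum>j\<in>J. const (c j) * var j)))"
      using insert.IH insert.prems by blast
    then show ?case using d eq by (rule preserves_comp)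
  qed
  \<comment> \<open>The diagonal coefficient is a scaling, inserted last; it leaves the sum over the
    other variables alone.\<close>
  let ?d = "var(i := const (1 + c i) * var i) :: 'm \<Rightarrow> ('m, 'a) mpoly"
  have "(\<Sum>k\<in>UNIV - {i}. subst ?d (const (c k) * var k)) = (\<Sum>k\<in>UNIV - {i}. const (c k) * var k)"
    by (intro sum.cong) (auto simp: subst_mult)
  then have eq: "(var(i := var i + (\<Sum>j\<in>UNIV. const (c j) * var j))) k
      = subst ?d ((var(i := var i + (\<Sum>j\<in>UNIV - {i}. const (c j) * var j))) k)" for k
    by (subst sum.remove[of UNIV i])
      (auto simp: subst_add subst_sum const_add const_1 distrib_right add.assoc)
  have "preserves L (var(i := var i + (\<Sum>j\<in>UNIV - {i}. const (c j) * var j)))"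
    by (rule sum) auto
  then show ?thesis using preserves_scaling eq by (rule preserves_comp)
qed

subsection \<open>Elimination along a preorder\<close>

text \<open>Right multiplication by the identity matrix with \<open>c\<close> added to its row
  \<open>i\<close>. One operation thus bundles the transvections and the scaling belonging to the
  variable \<open>i\<close>.\<close>

definition add_col :: "'n \<Rightarrow> ('n \<Rightarrow> 'a::field) \<Rightarrow> 'a ^ 'n ^ 'n \<Rightarrow> 'a ^ 'n ^ 'n" where
  "add_col i c A = (\<chi> k h. A $ k $ h + c h * A $ k $ i)"

lemma add_col_nth [simp]: "add_col i c A $ k $ h = A $ k $ h + c h * A $ k $ i"
  by (simp add: add_col_def)

text \<open>Column \<open>i\<close> itself has been multiplied by \<open>1 + c i\<close>, which
  explains the denominator.\<close>

lemma add_col_inverse: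
  assumes "1 + c i \<noteq> 0"
  shows "add_col i (\<lambda>h. - c h / (1 + c i)) (add_col i c A) = A"
proof -
  have "- c h / (1 + c i) * (a + c i * a) = - (c h * a)" for h a
  proof -
    have "a + c i * a = (1 + c i) * a" by (simp add: distrib_right)
    then show ?thesis using assms by simp
  qed
  then show ?thesis by (simp only: vec_eq_iff add_col_nth) simp
qed

lemma matrix_mult_add_col: "B ** add_col i c A = add_col i c (B ** A)"
  by (simp add: vec_eq_iff matrix_matrix_mult_def distrib_left sum.distrib sum_distrib_left mult.left_commute)

lemma invertible_add_col:
  fixes A :: "'a::field ^ 'n ^ 'n"
  assumes "invertible A" "1 + c i \<noteq> 0"
  shows "invertible (add_col i c A)"
proof -
  let ?X = "add_col i c (mat 1) :: 'a ^ 'n ^ 'n"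
  have "?X ** add_col i (\<lambda>h. - c h / (1 + c i)) (mat 1) = mat 1"
    unfolding matrix_mult_add_col using add_col_inverse[of c i] assms(2) by simp
  then have "invertible ?X" unfolding invertible_right_inverse by blast
  then have "invertible (A ** ?X)" using assms(1) by (rule invertible_mult[rotated])
  then show ?thesis by (simp add: matrix_mult_add_col)
qed

text \<open>Some term of the Leibniz expansion of the determinant is nonzero, hence so are all its
  factors.\<close>

lemma invertible_imp_permutation:
  fixes A :: "'a::field ^ 'n ^ 'n"
  assumes "invertible A"
  obtains \<sigma> where "\<sigma> permutes UNIV" "\<And>k. A $ k $ \<sigma> k \<noteq> 0"
proof -
  have "det A \<noteq> 0" using assms by (simp add: invertible_det_nz)
  then obtain \<sigma> where s: "\<sigma> \<in> {\<sigma>. \<sigma> permutes UNIV}"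
      "of_int (sign \<sigma>) * (\<Prod>k\<in>UNIV. A $ k $ \<sigma> k) \<noteq> 0"
    unfolding det_def by (rule sum.not_neutral_contains_not_neutral)
  then have "A $ k $ \<sigma> k \<noteq> 0" for k by auto
  then show ?thesis using that s(1) by blast
qed

text \<open>Gaussian elimination inside the incidence algebra of a preorder \<open>E\<close>. A zero pivot \<open>A $ i $ i\<close> can be
  repaired with a column \<open>j\<close> such that \<open>(j, i) \<in> E\<close> too, because a permutation contributing to
  the determinant of \<open>A\<close> maps the finite set of successors of \<open>j\<close> onto itself.\<close>

lemma invertible_preorder_induct [consumes 4, case_names one add_col]:
  fixes A :: "'a::field ^ 'n ^ 'n"
  assumes "invertible A" "\<forall>i j. A $ i $ j \<noteq> 0 \<longrightarrow> (i, j) \<in> E"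
    and "refl E" "trans E"
    and one: "P (mat 1)"
    and step: "\<And>A i c. P A \<Longrightarrow> (\<And>h. c h \<noteq> 0 \<Longrightarrow> (i, h) \<in> E) \<Longrightarrow> P (add_col i c A)"
  shows "P A"
  using assms(1,2)
\<comment> \<open>The measure counts the rows that are not yet those of the identity.\<close>
proof (induction "card {k. A $ k \<noteq> axis k 1}" arbitrary: A rule: less_induct)
  case less
  have refl: "(i, i) \<in> E" for i using \<open>refl E\<close> by (simp add: refl_on_def)
  have trans: "(i, j) \<in> E \<Longrightarrow> (j, k) \<in> E \<Longrightarrow> (i, k) \<in> E" for i j k
    using \<open>trans E\<close> by (rule transD)
  have supp: "\<forall>k h. add_col i c B $ k $ h \<noteq> 0 \<longrightarrow> (k, h) \<in> E"
    if B: "\<forall>i j. B $ i $ j \<noteq> 0 \<longrightarrow> (i, j) \<in> E" and c: "\<And>h. c h \<noteq> 0 \<Longrightarrow> (i, h) \<in> E"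
    for B :: "'a ^ 'n ^ 'n" and i c
  proof (intro allI impI)
    fix k h assume "add_col i c B $ k $ h \<noteq> 0"
    then have "B $ k $ h \<noteq> 0 \<or> (c h \<noteq> 0 \<and> B $ k $ i \<noteq> 0)" by auto
    then show "(k, h) \<in> E" using B c trans by blast
  qed
  \<comment> \<open>The inverse operation has coefficients on the same edges, so \<open>step\<close>
    carries \<open>P\<close> back from the simplified matrix.\<close>
  have undo: "P B" if "P (add_col i c B)" "1 + c i \<noteq> 0" "\<And>h. c h \<noteq> 0 \<Longrightarrow> (i, h) \<in> E"
    for B i c
    using step[OF that(1), of "\<lambda>h. - c h / (1 + c i)" i] that add_col_inverse[of c i B] by auto
  \<comment> \<open>\<open>B\<close> is \<open>A\<close> or \<open>A\<close> with a repaired pivot;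
    the measure is compared with that of \<open>A\<close>.\<close>
  have clear: "P B"
    if inv: "invertible B" and B: "\<forall>i j. B $ i $ j \<noteq> 0 \<longrightarrow> (i, j) \<in> E"
      and i: "A $ i \<noteq> axis i 1" "B $ i $ i \<noteq> 0"
      and fixed: "\<And>k. A $ k = axis k 1 \<Longrightarrow> B $ k = axis k 1" for B i
  proof -
    \<comment> \<open>Solves \<open>B $ i $ h + c h * B $ i $ i = axis i 1 $ h\<close>; in
      particular \<open>1 + c i\<close> is the inverse of the pivot.\<close>
    define c where "c = (\<lambda>h. if h = i then 1 / B $ i $ i - 1 else - B $ i $ h / B $ i $ i)"
    let ?C = "add_col i c B"
    have ci: "1 + c i \<noteq> 0" using i by (simp add: c_def)
    have cE: "(i, h) \<in> E" if "c h \<noteq> 0" for h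
      using that B refl by (cases "h = i") (auto simp: c_def)
    have Ci: "?C $ i = axis i 1"
      using i by (auto simp: vec_eq_iff axis_def c_def field_simps)
    have Ck: "?C $ k = axis k 1" if "A $ k = axis k 1" for k
    proof -
      have "k \<noteq> i" using that i by auto
      then show ?thesis using fixed[OF that] by (simp add: vec_eq_iff axis_def)
    qed
    have "{k. ?C $ k \<noteq> axis k 1} \<subset> {k. A $ k \<noteq> axis k 1}"
      using Ck Ci i(1) by auto
    then have "card {k. ?C $ k \<noteq> axis k 1} < card {k. A $ k \<noteq> axis k 1}"
      by (intro psubset_card_mono) auto
    then have "P ?C"
      using less.hyps invertible_add_col[of B c i] inv ci supp B cE by blast
    then show "P B" using undo ci cE by blast
  qed
  show ?case
  proof (cases "\<forall>k. A $ k = axis k 1")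
    case True
    then have "A = mat 1" by (auto simp: vec_eq_iff mat_def axis_def)
    then show ?thesis using one by simp
  next
    case False
    then obtain i where i: "A $ i \<noteq> axis i 1" by blast
    show ?thesis
    proof (cases "A $ i $ i = 0")
      case False
      then show ?thesis using clear[OF less.prems i False] by blast
    next
      case True
      obtain \<sigma> where \<sigma>: "\<sigma> permutes UNIV" "\<And>k. A $ k $ \<sigma> k \<noteq> 0"
        using invertible_imp_permutation less.prems(1) by blast
      define j where "j = \<sigma> i"
      have ij: "A $ i $ j \<noteq> 0" unfolding j_def by (rule \<sigma>(2))
      then have "i \<noteq> j" using True by metis
      have "(j, i) \<in> E"
      proof -
        let ?S = "{k. (j, k) \<in> E}"
        \<comment> \<open>Each k has an edge to \<sigma> k. Since \<sigma> permutes the successors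
          of \<open>j\<close> and j = \<sigma> i is one of them, injectivity puts \<open>i\<close>
          among them.\<close>
        have "\<sigma> ` ?S \<subseteq> ?S" using less.prems(2) \<sigma>(2) trans by blast
        then have "\<sigma> ` ?S = ?S"
          using \<sigma>(1) by (intro endo_inj_surj) (auto simp: permutes_inj_on)
        moreover have "\<sigma> i \<in> ?S" using refl by (simp add: j_def)
        ultimately have "\<sigma> i \<in> \<sigma> ` ?S" by simp
        then have "i \<in> ?S" using inj_image_mem_iff[OF permutes_inj[OF \<sigma>(1)]] by blast
        then show ?thesis by simp
      qed
      \<comment> \<open>Adds column \<open>j\<close> to column \<open>i\<close>, so that the pivot
        becomes \<open>A $ i $ j\<close>.\<close>
      define c where "c = (\<lambda>h. if h = i then 1 else 0 :: 'a)"
      have cj: "1 + c j \<noteq> 0" using \<open>i \<noteq> j\<close> by (simp add: c_def)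
      have cE: "(j, h) \<in> E" if "c h \<noteq> 0" for h
        using that \<open>(j, i) \<in> E\<close> by (auto simp: c_def split: if_splits)
      \<comment> \<open>A finished row \<open>j\<close> would be spoiled by this addition. But a
        finished row k forces \<sigma> k = k, while \<sigma> already sends \<open>i\<close> to
        \<open>j\<close>.\<close>
      have jk: "j \<noteq> k" if "A $ k = axis k 1" for k
      proof
        assume "j = k"
        have "\<sigma> k \<noteq> \<sigma> i"
          using inj_eq[OF permutes_inj[OF \<sigma>(1)]] \<open>i \<noteq> j\<close> \<open>j = k\<close> by simp
        then have "\<sigma> k \<noteq> k" using \<open>j = k\<close> j_def by simp
        then have "A $ k $ \<sigma> k = 0" unfolding that by (simp add: axis_def)
        then show False using \<sigma>(2) by simp
      qed
      have "P (add_col j c A)"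
      proof (rule clear[OF _ _ i])
        show "invertible (add_col j c A)" using invertible_add_col less.prems(1) cj by blast
        show "\<forall>k h. add_col j c A $ k $ h \<noteq> 0 \<longrightarrow> (k, h) \<in> E"
          using supp[OF less.prems(2) cE] .
        show "add_col j c A $ i $ i \<noteq> 0" using True ij by (simp add: c_def)
        show "add_col j c A $ k = axis k 1" if "A $ k = axis k 1" for k
          using that jk[OF that] by (simp add: vec_eq_iff axis_def)
      qed
      then show ?thesis using undo cj cE by blast
    qed
  qed
qed

text \<open>Replacing the variable \<open>i\<close> by itself plus a linear form with coefficients
  \<open>c\<close> acts on the rows of \<open>A\<close>, read as linear forms, exactly as
  \<open>add_col i c\<close>.\<close>

lemma preserves_linear:
  fixes L :: "'m::finite monomial set" and A :: "'a::{field,finite} ^ 'm ^ 'm"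
  assumes "invertible A" "A \<in> stable_matrices L"
  shows "preserves L (\<lambda>k. \<Sum>h\<in>UNIV. const (A $ k $ h) * var h)"
proof -
  let ?E = "move_edges CHAR('a) L"
  have prime: "prime CHAR('a)"
    by (rule prime_CHAR_semidom) (rule finite_imp_CHAR_pos, simp)
  note assms(1)
  moreover have "\<forall>i j. A $ i $ j \<noteq> 0 \<longrightarrow> (i, j) \<in> ?E"
    using assms(2) borel_edges_subset_move_edges[OF prime, of L] by (auto simp: stable_matrices_def)
  moreover have "refl ?E" by (rule refl_onI) (rule move_edges_refl)
  moreover have "trans ?E" by (rule transI) (rule move_edges_trans[OF prime])
  ultimately show ?thesis
  proof (induction rule: invertible_preorder_induct)
    case one
    have "(\<lambda>k. \<Sum>h\<in>UNIV. const ((mat 1 :: 'a ^ 'm ^ 'm) $ k $ h) * var h) = var"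
      by (auto simp: mat_def if_distrib if_distribR const_1 cong: if_cong)
    then show ?case using preserves_var by simp
  next
    case (add_col A i c)
    let ?r = "\<Sum>j\<in>UNIV. const (c j) * var j"
    let ?d = "var(i := var i + ?r)"
    show ?case
    proof (rule preserves_comp[OF add_col(1)])
      show "preserves L ?d" by (rule preserves_upd_linear) (rule add_col(2))
      fix k
      have "subst ?d (\<Sum>h\<in>UNIV. const (A $ k $ h) * var h)
          = (\<Sum>h\<in>UNIV. const (A $ k $ h) * var h + (if h = i then const (A $ k $ h) * ?r else 0))"
        unfolding subst_sum by (intro sum.cong) (auto simp: subst_mult distrib_left)
      also have "\<dots> = (\<Sum>h\<in>UNIV. const (A $ k $ h) * var h) + const (A $ k $ i) * ?r"
        by (simp add: sum.distrib)
      also have "\<dots> = (\<Sum>h\<in>UNIV. const (A $ k $ h) * var h + const (A $ k $ i) * (const (c h) * var h))"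
        by (simp only: sum.distrib sum_distrib_left)
      also have "\<dots> = (\<Sum>h\<in>UNIV. const (add_col i c A $ k $ h) * var h)"
        by (intro sum.cong refl) (simp only: add_col_nth const_add const_mult distrib_left mult_ac)
      finally show "(\<Sum>h\<in>UNIV. const (add_col i c A $ k $ h) * var h)
          = subst ?d (\<Sum>h\<in>UNIV. const (A $ k $ h) * var h)" by simp
    qed
  qed
qed

lemma preserves_affine:
  fixes L :: "'m::finite monomial set" and A :: "'a::{field,finite} ^ 'm ^ 'm"
  assumes "\<And>u v. u \<in> L \<Longrightarrow> mon_dvd v u \<Longrightarrow> v \<in> L"
    and "invertible A" "A \<in> stable_matrices L"
  shows "preserves L (affine_coord (A, b))"
proof -
  have "preserves L (\<lambda>i. var i + const (b $ i))"
    using preserves_translation[of L "\<lambda>i. b $ i"] assms(1) by blast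
  moreover have "affine_coord (A, b) i
      = subst (\<lambda>k. \<Sum>h\<in>UNIV. const (A $ k $ h) * var h) (var i + const (b $ i))" for i
    by (simp add: subst_add affine_coord_def)
  ultimately show ?thesis
    by (rule preserves_comp[OF _ preserves_linear[OF assms(2,3)]])
qed

subsection \<open>Reduced polynomials\<close>

text \<open>Induction over the variables. Monomials agreeing on \<open>I\<close> are
  indistinguishable there, so only sums of their coefficients are controlled; for
  \<open>I = UNIV\<close> the sum has at most one term.\<close>

lemma reduced_sum_coeff_zero:
  fixes c :: "'m::finite monomial \<Rightarrow> 'a::{field,finite}"
  assumes "finite I" "finite U" "\<And>u i. u \<in> U \<Longrightarrow> Poly_Mapping.lookup u i < CARD('a)"
    and "\<And>P. (\<Sum>u\<in>U. c u * (\<Prod>i\<in>I. P i ^ Poly_Mapping.lookup u i)) = 0"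
  shows "(\<Sum>u | u \<in> U \<and> (\<forall>i\<in>I. Poly_Mapping.lookup u i = Poly_Mapping.lookup v i). c u) = 0"
  using assms
proof (induction I arbitrary: U)
  case empty
  then show ?case by simp
next
  case (insert i I)
  let ?l = "\<lambda>u. Poly_Mapping.lookup u i"
  define U' where "U' = {u \<in> U. ?l u = ?l v}"
  let ?t = "\<lambda>P u. c u * (\<Prod>j\<in>I. P j ^ Poly_Mapping.lookup u j)"
  have "(\<Sum>u\<in>U'. ?t P u) = 0" for P
  proof (cases "?l v < CARD('a)")
    case True
    \<comment> \<open>The polynomial in the variable \<open>i\<close> alone, the others fixed at
      \<open>P\<close>: its degree is below q, yet all q field elements are roots.\<close>
    define f where "f = (\<Sum>k<CARD('a). monom (\<Sum>u | u \<in> U \<and> ?l u = k. ?t P u) k)"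
    have "poly f x = 0" for x
    proof -
      have "poly f x = (\<Sum>k<CARD('a). \<Sum>u | u \<in> U \<and> ?l u = k. ?t P u * x ^ ?l u)"
        by (simp add: f_def poly_sum poly_monom sum_distrib_right)
      also have "\<dots> = (\<Sum>u\<in>U. ?t P u * x ^ ?l u)"
        using insert.prems(1,2) by (intro sum.group) auto
      also have "\<dots> = (\<Sum>u\<in>U. c u * (\<Prod>j\<in>insert i I. (P(i := x)) j ^ Poly_Mapping.lookup u j))"
      proof (rule sum.cong)
        fix u
        have "(\<Prod>j\<in>I. (P(i := x)) j ^ Poly_Mapping.lookup u j) = (\<Prod>j\<in>I. P j ^ Poly_Mapping.lookup u j)"
          using insert.hyps(2) by (intro prod.cong) auto
        then show "?t P u * x ^ ?l u = c u * (\<Prod>j\<in>insert i I. (P(i := x)) j ^ Poly_Mapping.lookup u j)"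
          using insert.hyps by (simp add: mult_ac)
      qed simp
      also have "\<dots> = 0" by (rule insert.prems(3))
      finally show ?thesis .
    qed
    then have roots: "{x. poly f x = 0} = UNIV" by auto
    have "degree f \<le> CARD('a) - 1"
      unfolding f_def by (intro degree_sum_le) (auto intro: order_trans[OF degree_monom_le])
    then have "degree f < CARD('a)"
      using zero_less_card_finite[where 'a = 'a] by linarith
    then have "f = 0"
      using card_poly_roots_bound[of f] roots by auto
    then have "coeff f (?l v) = 0" by simp
    then show ?thesis
      using True by (simp add: f_def coeff_sum coeff_monom U'_def)
  next
    case False
    have "u \<notin> U'" for u
      using insert.prems(2)[of u i] False by (simp add: U'_def) metis
    then have "U' = {}" by blast
    then show ?thesis by simp
  qed
  moreover have "finite U'" "\<And>u i. u \<in> U' \<Longrightarrow> Poly_Mapping.lookup u i < CARD('a)"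
    using insert.prems(1,2) by (simp_all add: U'_def)
  ultimately have "(\<Sum>u | u \<in> U' \<and> (\<forall>j\<in>I. Poly_Mapping.lookup u j = Poly_Mapping.lookup v j). c u) = 0"
    by (intro insert.IH)
  then show ?case by (simp add: U'_def conj_assoc)
qed

lemma keys_span:
  assumes "f \<in> mpoly.span (mon ` L)"
  shows "Poly_Mapping.keys f \<subseteq> L"
  using assms
proof (induction rule: mpoly.span_induct_alt)
  case base
  then show ?case by simp
next
  case (step a x y)
  then obtain u where u: "x = mon u" "u \<in> L" by blast
  have "scale a x = Poly_Mapping.single u a"
    by (simp add: u scale_def const_def mon_def mult_single)
  then have "Poly_Mapping.keys (scale a x) \<subseteq> L" using u by auto
  then show ?case using step.IH keys_add[of "scale a x" y] by blast
qed

text \<open>Evaluation at a point is substitution of constants, which makes the homomorphism laws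
  available for it.\<close>

lemma subst_consts:
  "subst (\<lambda>i. const (P i)) f =
    const (\<Sum>u\<in>Poly_Mapping.keys f. Poly_Mapping.lookup f u * (\<Prod>i\<in>UNIV. P i ^ Poly_Mapping.lookup u i))"
proof -
  have sum: "const (\<Sum>x\<in>X. g x) = (\<Sum>x\<in>X. const (g x))" for g :: "'x \<Rightarrow> 'b" and X
    by (induction X rule: infinite_finite_induct) (simp_all add: const_add)
  have prod: "const (\<Prod>x\<in>X. g x) = (\<Prod>x\<in>X. const (g x))" for g :: "'x \<Rightarrow> 'b" and X
    by (induction X rule: infinite_finite_induct) (simp_all add: const_1 const_mult)
  show ?thesis
    by (simp only: subst_def mono_subst_def sum prod const_mult const_power)
qed

lemma reduced_eq_0:
  fixes f :: "('m::finite, 'a::{field,finite}) mpoly"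
  assumes "\<And>u i. u \<in> Poly_Mapping.keys f \<Longrightarrow> Poly_Mapping.lookup u i < CARD('a)"
    and "\<And>P. subst (\<lambda>i. const (P i)) f = (0 :: ('m, 'a) mpoly)"
  shows "f = 0"
proof (rule poly_mapping_eqI)
  fix v
  have inj: "a = 0" if "const a = (0 :: ('m, 'a) mpoly)" for a
    using that by (simp add: const_def) (metis lookup_single_eq lookup_zero)
  have "(\<Sum>u\<in>Poly_Mapping.keys f. Poly_Mapping.lookup f u * (\<Prod>i\<in>UNIV. P i ^ Poly_Mapping.lookup u i)) = 0" for P
    by (rule inj) (use assms(2)[of P] in \<open>simp only: subst_consts\<close>)
  then have "(\<Sum>u | u \<in> Poly_Mapping.keys f \<and> (\<forall>i\<in>UNIV. Poly_Mapping.lookup u i = Poly_Mapping.lookup v i).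
      Poly_Mapping.lookup f u) = 0"
    by (intro reduced_sum_coeff_zero) (use assms(1) in auto)
  moreover have "{u. u \<in> Poly_Mapping.keys f \<and> (\<forall>i\<in>UNIV. Poly_Mapping.lookup u i = Poly_Mapping.lookup v i)}
      = Poly_Mapping.keys f \<inter> {v}"
    by (auto intro: poly_mapping_eqI)
  ultimately show "Poly_Mapping.lookup f v = Poly_Mapping.lookup 0 v"
    by (cases "v \<in> Poly_Mapping.keys f") (auto simp: in_keys_iff)
qed

lemma subst_vanishing_ideal:
  fixes f :: "('m::finite, 'a::{field,finite}) mpoly"
  assumes "f \<in> vanishing_ideal S" "\<And>i. P i \<in> S i"
  shows "subst (\<lambda>i. const (P i)) f = (0 :: ('m, 'a) mpoly)"
  using assms(1) unfolding vanishing_ideal_def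
proof (induction rule: mpoly_ideal.span_induct_alt)
  case base
  then show ?case by simp
next
  case (step g x h)
  then obtain j where x: "x = (\<Prod>\<alpha>\<in>S j. (var j - const \<alpha>))" by blast
  have "subst (\<lambda>i. const (P i)) x = (\<Prod>\<alpha>\<in>S j. const (P j) - const \<alpha> :: ('m, 'a) mpoly)"
    by (simp add: x subst_prod subst_diff)
  also have "\<dots> = 0"
    using assms(2)[of j] by (intro prod_zero) auto
  finally show ?case using step.IH by (simp add: subst_add subst_mult)
qed

text \<open>The description operator needs uniqueness: two candidates differ by a reduced polynomial
  vanishing at every point, which is 0.\<close>

lemma reduce_id:
  fixes g :: "('m::finite, 'a::{field,finite}) mpoly"
  assumes "g \<in> mpoly.span (mon ` Delta (\<lambda>_. UNIV :: 'a set))"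
  shows "reduce (\<lambda>_. UNIV) g = g"
  unfolding reduce_def
proof (rule the_equality)
  show "g \<in> mpoly.span (mon ` Delta (\<lambda>_. UNIV :: 'a set)) \<and> g - g \<in> vanishing_ideal (\<lambda>_. UNIV)"
    using assms mpoly_ideal.span_zero by (simp add: vanishing_ideal_def)
next
  fix h :: "('m, 'a) mpoly"
  assume h: "h \<in> mpoly.span (mon ` Delta (\<lambda>_. UNIV :: 'a set)) \<and> g - h \<in> vanishing_ideal (\<lambda>_. UNIV)"
  then have "g - h \<in> mpoly.span (mon ` Delta (\<lambda>_. UNIV :: 'a set))"
    using assms by (intro mpoly.span_diff) auto
  then have "Poly_Mapping.keys (g - h) \<subseteq> Delta (\<lambda>_. UNIV :: 'a set)" by (rule keys_span)
  then have "Poly_Mapping.lookup u i < CARD('a)" if "u \<in> Poly_Mapping.keys (g - h)" for u i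
    using that unfolding Delta_def by blast
  moreover have "subst (\<lambda>i. const (P i)) (g - h) = (0 :: ('m, 'a) mpoly)" for P
    using h by (intro subst_vanishing_ideal[of _ "\<lambda>_. UNIV"]) auto
  ultimately have "g - h = 0" by (rule reduced_eq_0)
  then show "h = g" by simp
qed

lemma surj_affine_point:
  assumes "invertible A"
  shows "surj (affine_point (A, b))"
proof -
  obtain B where B: "A ** B = mat 1"
    using assms unfolding invertible_def by blast
  show ?thesis
  proof (rule surjI)
    show "affine_point (A, b) (B *v (Q - b)) = Q" for Q
      by (simp add: affine_point_def matrix_vector_mul_assoc B)
  qed
qed

theorem theorem2:
  fixes L :: "'m::finite monomial set"
  assumes "\<And>u i. u \<in> L \<Longrightarrow> Poly_Mapping.lookup u i < CARD('a::{field,finite})"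
    and "\<And>u v. u \<in> L \<Longrightarrow> mon_dvd v u \<Longrightarrow> v \<in> L"
  shows "{(A, b). A \<in> stable_matrices L \<and> invertible A} \<subseteq>
    (affine_perms (\<lambda>_. UNIV) L :: (('a ^ 'm ^ 'm) \<times> ('a ^ 'm)) set)"
proof (intro subsetI, clarify)
  fix A :: "'a ^ 'm ^ 'm" and b :: "'a ^ 'm"
  assume A: "A \<in> stable_matrices L" "invertible A"
  have "L \<subseteq> Delta (\<lambda>_. UNIV :: 'a set)"
    using assms(1) by (auto simp: Delta_def)
  then have sub: "mpoly.span (mon ` L) \<subseteq> mpoly.span (mon ` Delta (\<lambda>_. UNIV :: 'a set))"
    by (intro mpoly.span_mono image_mono)
  have "preserves L (affine_coord (A, b))"
    using assms(2) A(2,1) by (rule preserves_affine)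
  then have "affine_subst (A, b) (mon u) \<in> mpoly.span (mon ` L)" if "u \<in> L" for u
    using that unfolding preserves_def affine_subst_mon by blast
  then have "reduce (\<lambda>_. UNIV) (affine_subst (A, b) (mon u)) \<in> mpoly.span (mon ` L)" if "u \<in> L" for u
    using that sub by (subst reduce_id) blast+
  moreover have "affine_point (A, b) ` cartesian (\<lambda>_. UNIV) = cartesian (\<lambda>_. UNIV)"
    using surj_affine_point[OF A(2)] by (simp add: cartesian_def)
  ultimately show "(A, b) \<in> affine_perms (\<lambda>_. UNIV) L"
    unfolding affine_perms_def by blast
qed

end
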